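(* Let $\mathcal{B}$ be the observation operator defined, for $\boldsymbol\xi\in\mathbb{R}^N$ and $u\in\mathscr{U}=L^2(\Omega\times T)$, by $$(\mathcal{B}(\boldsymbol\xi)u)_k=\langle\!\langle \tau_k\,\delta_{\boldsymbol r}(\boldsymbol\xi),u\rangle\!\rangle,\qquad k\in\{1,\dots,n_y\},$$ with the path $\boldsymbol r$, the measurement times $t_1,\dots,t_{n_y}$ and the mollifiers $\delta_{\boldsymbol r}(\boldsymbol\xi)$, $\tau_k$ (with scaling constants $\varepsilon_{\boldsymbol x},\varepsilon_t>0$) as in the context. Then $\mathcal{B}$ satisfies the following properties: 1. if $u\in C(\Omega\times T)$, then $$\lim_{(\varepsilon_{\boldsymbol x},\varepsilon_t)\to(0,0)}(\mathcal{B}(\boldsymbol\xi)u)_k=u(\boldsymbol r_k(\boldsymbol\xi),t_k),\qquad\text{where } \boldsymbol r_k(\boldsymbol\xi)=\boldsymbol r(t_k;\boldsymbol\xi);$$ 2. $\mathcal{B}(\boldsymbol\xi)\in\mathcal{L}(\mathscr{U},\mathbb{R}^{n_y})$ for all $\boldsymbol\xi\in\mathbb{R}^N$; 3. $\mathcal{B}(\cdot):\mathbb{R}^N\to\mathcal{L}(\mathscr{U},\mathbb{R}^{n_y})$ is continuous in operator norm; and 4. the adjoint $\mathcal{B}^*$ of $\mathcal{B}$ satisfies $$\mathcal{B}^*(\boldsymbol\xi)\boldsymbol y=\delta_{\boldsymbol r}(\boldsymbol\xi)\sum_{k=1}^{n_y}\tau_k y_k,\qquad \boldsymbol y\in\m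athbb{R}^{n_y}.$$
   Context: $\Omega\subset\mathbb{R}^2$ is an open, bounded, convex set and $T\subset\mathbb{R}$ is a bounded time interval. $\mathscr{U}=L^2(\Omega\times T)$ (real-valued functions) has inner product $\langle\!\langle u,v\rangle\!\rangle=\int_T\int_\Omega u(\boldsymbol x,t)v(\boldsymbol x,t)\,d\boldsymbol x\,dt$; $\mathbb{R}^{n_y}$ carries the Euclidean inner product; $\mathcal{L}(X,Y)$ is the Banach space of bounded linear operators from $X$ to $Y$. A parameterized path is a map $\boldsymbol r:T_y\times\mathbb{R}^N\to\Omega$, $(t,\boldsymbol\xi)\mapsto\boldsymbol r(t;\boldsymbol\xi)$, where $T_y\subset T$ is called the inversion interval; the partial derivatives of $\boldsymbol r$ with respect to the path parameter $\boldsymbol\xi$ are assumed to exist and to be continuous. The measurement times are $\{t_k\}_{k=1}^{n_y}\subset T_y$. For constants $\varepsilon_{\boldsymbol x},\varepsilon_t>0$ the mollifiers are $$\delta_{\boldsymbol r}(\boldsymbol x,t)(\boldsymbol\xi)=(2\pi\varepsilon_{\boldsymbol x})^{-1}\exp\Big\{-\frac{\|\boldsymbol x-\boldsymbol r(t;\boldsymbol\xi)\|_2^2}{2\varepsilon_{\boldsymbol x}}\Big\},\qquad \tau_k(t)=\big(\sqrt{2\pi\varepsilon_t}\big)^{-1}\exp\Big\{-\frac{(t-t_k)^2}{2\varepsilon_t}\Big\},$$ and $\delta_{\boldsymbol r}(\boldsymbol\xi)$ denotes the function $(\boldsymbol x,t)\mapsto\delta_{\boldsymbol r}(\boldsymbol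 x,t)(\boldsymbol\xi)$.
   Formalization: Item 1 takes t_k interior to T_y (at an endpoint the limit is half the value) and reads C(Ω×T) as bounded continuous functions; t↦r(t;ξ) is assumed continuous on T_y, and δ_r is extended by zero for times outside T_y. *)

theory Defs
  imports "HOL-Analysis.Analysis"
begin

section \<open>The space \<open>L\<^sup>2(\<Omega> \<times> T)\<close>\<close>

text \<open>
  \<open>L\<^sup>2(\<Omega> \<times> T)\<close> depends on the sets \<open>\<Omega>\<close> and \<open>T\<close>, so it is not a type. Its elements are
  represented by square-integrable functions, and equality of elements is equality almost
  everywhere on \<open>\<Omega> \<times> T\<close>. Values outside \<open>\<Omega> \<times> T\<close> are irrelevant.
\<close>

type_synonym st_point = "(real ^ 2) \<times> real"

definition L2_space :: "(real ^ 2) set \<Rightarrow> real set \<Rightarrow> (st_point \<Rightarrow> real) set" where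
  "L2_space \<Omega> T = {u \<in> borel_measurable (lebesgue_on (\<Omega> \<times> T)).
     integrable (lebesgue_on (\<Omega> \<times> T)) (\<lambda>p. (u p)\<^sup>2)}"

definition L2_inner ::
  "(real ^ 2) set \<Rightarrow> real set \<Rightarrow> (st_point \<Rightarrow> real) \<Rightarrow> (st_point \<Rightarrow> real) \<Rightarrow> real" where
  "L2_inner \<Omega> T u v =
     (\<integral>t. (\<integral>x. u (x, t) * v (x, t) \<partial>lebesgue_on \<Omega>) \<partial>lebesgue_on T)"

definition L2_norm :: "(real ^ 2) set \<Rightarrow> real set \<Rightarrow> (st_point \<Rightarrow> real) \<Rightarrow> real" where
  "L2_norm \<Omega> T u = sqrt (L2_inner \<Omega> T u u)"

section \<open>Bounded linear operators from \<open>L\<^sup>2(\<Omega> \<times> T)\<close> to \<open>\<real>\<^sup>n\<close>\<close>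

text \<open>
  Linearity and the norm bound force \<open>A u = A v\<close> whenever \<open>u = v\<close> almost everywhere, so
  members of this set descend to equivalence classes.
\<close>

definition L2_bounded_operators ::
  "(real ^ 2) set \<Rightarrow> real set \<Rightarrow> ((st_point \<Rightarrow> real) \<Rightarrow> real ^ 'm) set" where
  "L2_bounded_operators \<Omega> T = {A.
     (\<forall>u\<in>L2_space \<Omega> T. \<forall>v\<in>L2_space \<Omega> T. A (\<lambda>p. u p + v p) = A u + A v) \<and>
     (\<forall>c. \<forall>u\<in>L2_space \<Omega> T. A (\<lambda>p. c * u p) = c *\<^sub>R A u) \<and>
     (\<exists>K. \<forall>u\<in>L2_space \<Omega> T. norm (A u) \<le> K * L2_norm \<Omega> T u)}"

text \<open>
  The counterpart of \<^const>\<open>onorm\<close>; as there, the quotient is \<open>0\<close> when the denominator is.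
\<close>

definition L2_onorm ::
  "(real ^ 2) set \<Rightarrow> real set \<Rightarrow> ((st_point \<Rightarrow> real) \<Rightarrow> real ^ 'm) \<Rightarrow> real" where
  "L2_onorm \<Omega> T A = (SUP u\<in>L2_space \<Omega> T. norm (A u) / L2_norm \<Omega> T u)"

text \<open>
  An adjoint is determined by the operator only up to equality almost everywhere of its values;
  \<open>L2_adjoint\<close> picks a representative.
\<close>

definition is_L2_adjoint ::
  "(real ^ 2) set \<Rightarrow> real set \<Rightarrow> ((st_point \<Rightarrow> real) \<Rightarrow> real ^ 'm) \<Rightarrow>
   (real ^ 'm \<Rightarrow> st_point \<Rightarrow> real) \<Rightarrow> bool" where
  "is_L2_adjoint \<Omega> T A A' \<longleftrightarrow>
     (\<forall>y. A' y \<in> L2_space \<Omega> T \<and> (\<forall>u\<in>L2_space \<Omega> T. A u \<bullet> y = L2_inner \<Omega> T u (A' y)))"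

definition L2_adjoint ::
  "(real ^ 2) set \<Rightarrow> real set \<Rightarrow> ((st_point \<Rightarrow> real) \<Rightarrow> real ^ 'm) \<Rightarrow>
   real ^ 'm \<Rightarrow> st_point \<Rightarrow> real" where
  "L2_adjoint \<Omega> T A = (SOME A'. is_L2_adjoint \<Omega> T A A')"

section \<open>Paths, mollifiers and the observation operator\<close>

text \<open>
  \<open>r t \<xi>\<close> is only meaningful for \<open>t\<close> in the inversion interval \<open>Ty\<close>. Being a path, it is
  continuous in time; \<open>D i t \<xi>\<close> is the partial derivative with respect to the \<open>i\<close>-th component
  of \<open>\<xi>\<close>.
\<close>

definition parameterized_path ::
  "(real ^ 2) set \<Rightarrow> real set \<Rightarrow> (real \<Rightarrow> real ^ 'N \<Rightarrow> real ^ 2) \<Rightarrow> bool" where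
  "parameterized_path \<Omega> Ty r \<longleftrightarrow>
     (\<forall>t\<in>Ty. \<forall>\<xi>. r t \<xi> \<in> \<Omega>) \<and>
     (\<forall>\<xi>. continuous_on Ty (\<lambda>t. r t \<xi>)) \<and>
     (\<exists>D :: 'N \<Rightarrow> real \<Rightarrow> real ^ 'N \<Rightarrow> real ^ 2.
        (\<forall>i. \<forall>t\<in>Ty. \<forall>\<xi>.
           ((\<lambda>s. r t (\<xi> + s *\<^sub>R axis i 1)) has_vector_derivative D i t \<xi>) (at 0)) \<and>
        (\<forall>i. continuous_on (Ty \<times> UNIV) (\<lambda>(t, \<xi>). D i t \<xi>)))"

text \<open>
  The path exists only for times in \<open>Ty\<close>, whereas the inner product integrates over all of \<open>T\<close>;
  the spatial mollifier is extended by zero to times outside \<open>Ty\<close>.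
\<close>

definition space_mollifier ::
  "real \<Rightarrow> real set \<Rightarrow> (real \<Rightarrow> real ^ 'N \<Rightarrow> real ^ 2) \<Rightarrow> real ^ 'N \<Rightarrow> st_point \<Rightarrow> real" where
  "space_mollifier \<epsilon>x Ty r \<xi> = (\<lambda>(x, t).
     if t \<in> Ty then 1 / (2 * pi * \<epsilon>x) * exp (- ((norm (x - r t \<xi>))\<^sup>2 / (2 * \<epsilon>x))) else 0)"

definition time_mollifier :: "real \<Rightarrow> real \<Rightarrow> real \<Rightarrow> real" where
  "time_mollifier \<epsilon>t tk t = 1 / sqrt (2 * pi * \<epsilon>t) * exp (- ((t - tk)\<^sup>2 / (2 * \<epsilon>t)))"

definition observation_operator ::
  "(real ^ 2) set \<Rightarrow> real set \<Rightarrow> real set \<Rightarrow> (real \<Rightarrow> real ^ 'N \<Rightarrow> real ^ 2) \<Rightarrow> ('m \<Rightarrow> real) \<Rightarrow>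
   real \<Rightarrow> real \<Rightarrow> real ^ 'N \<Rightarrow> (st_point \<Rightarrow> real) \<Rightarrow> real ^ 'm" where
  "observation_operator \<Omega> T Ty r \<theta> \<epsilon>x \<epsilon>t \<xi> u =
     (\<chi> k. L2_inner \<Omega> T
        (\<lambda>(x, t). time_mollifier \<epsilon>t (\<theta> k) t * space_mollifier \<epsilon>x Ty r \<xi> (x, t)) u)"

end

theory Submission
  imports Defs "HOL-Probability.Distributions"
begin

text \<open>
  Each component of the observation operator is the inner product \<open>\<langle>g k \<xi>, u\<rangle>\<close> with a kernel
  \<open>g k \<xi> = \<tau>\<^sub>k \<delta>\<^sub>r(\<xi>)\<close> that does not depend on \<open>u\<close>. The kernel is bounded, uniformly in \<open>\<xi>\<close>, and
  \<open>\<Omega> \<times> T\<close> has finite measure, so \<open>g k \<xi>\<close> belongs to \<open>L\<^sup>2\<close>. All but the limit statement follow from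
  this representation.

  Boundedness is the Cauchy--Schwarz inequality (\<open>L2_inner_vector_bounded\<close>). The same inequality
  bounds the operator norm of a difference by \<open>\<Sum>k. \<parallel>g k \<xi> - g k \<xi>0\<parallel>\<close>, and each summand tends to \<open>0\<close>
  by dominated convergence (\<open>observation_kernel_L2_continuous\<close>). The pointwise convergence which this
  needs is continuity of \<open>\<xi> \<mapsto> r t \<xi>\<close> for fixed \<open>t\<close>, a consequence of the continuity of the partial
  derivatives (\<open>continuous_on_of_continuous_partials\<close>). The adjoint is computed by exchanging the
  finite sum over \<open>k\<close> with the integral, and an adjoint is unique up to null sets
  (\<open>is_L2_adjoint_unique\<close>).

  For the limit, the substitutions \<open>x = r t \<xi> + sqrt \<epsilon>x y\<close> and \<open>t = \<theta> k + sqrt \<epsilon>t s\<close> turn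
  \<open>\<langle>g k \<xi>, u\<rangle>\<close> into an average of values of \<open>u\<close>, extended by zero, against the standard Gaussian
  density in \<open>(y, s)\<close> (\<open>L2_inner_observation_kernel_rescaled\<close>). The density no longer depends on
  \<open>\<epsilon>x\<close> and \<open>\<epsilon>t\<close>, and the point at which \<open>u\<close> is evaluated tends to \<open>(r (\<theta> k) \<xi>, \<theta> k)\<close>; dominated
  convergence concludes.

  The limit works directly with the iterated integral that defines the inner product; linearity and
  the Cauchy--Schwarz inequality need it as one integral over \<open>\<Omega> \<times> T\<close>. The two forms are
  identified by a version of Fubini's theorem for the completed measure (\<open>lebesgue_Fubini\<close>).
\<close>

section \<open>Fubini's theorem and the Cauchy--Schwarz inequality\<close>

text \<open>
  Completeness of Lebesgue measure: the set where \<open>f\<close> differs from \<open>g\<close> is negligible, and so is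
  each of its subsets, whatever \<open>f\<close> does there.
\<close>
lemma lebesgue_measurable_AE_eq:
  fixes f g :: "'a::euclidean_space \<Rightarrow> real"
  assumes g[measurable]: "g \<in> borel_measurable borel" and eq: "AE x in lborel. f x = g x"
  shows "f \<in> borel_measurable lebesgue"
proof -
  have "g \<in> borel_measurable lebesgue"
    by (intro measurable_completion) simp
  moreover have "{x. f x \<noteq> g x} \<in> null_sets lebesgue"
    using AE_completion[OF eq] by (simp add: completion.AE_iff_null_sets)
  then have "negligible {x. f x \<noteq> g x}"
    by (simp add: negligible_iff_null_sets)
  ultimately show ?thesis
  proof (intro borel_measurable_iff_greater[THEN iffD2] allI)
    fix a
    let ?N = "{x. f x \<noteq> g x}"
    assume g: "g \<in> borel_measurable lebesgue" and N: "negligible ?N"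
    have "?N \<in> sets lebesgue" "?N \<inter> {x. a < f x} \<in> sets lebesgue"
      using N by (auto intro!: negligible_imp_sets intro: negligible_subset)
    moreover have "{x. a < g x} \<in> sets lebesgue"
      using g by (auto simp: borel_measurable_iff_greater)
    ultimately have "({x. a < g x} - ?N) \<union> (?N \<inter> {x. a < f x}) \<in> sets lebesgue"
      by (intro sets.Un sets.Diff)
    also have "({x. a < g x} - ?N) \<union> (?N \<inter> {x. a < f x}) = {x. a < f x}"
      by auto
    finally have "{x. a < f x} \<in> sets lebesgue" .
    then show "{x \<in> space lebesgue. a < f x} \<in> sets lebesgue"
      by simp
  qed
qed

lemma lebesgue_integral_AE_eq:
  fixes f g :: "'a::euclidean_space \<Rightarrow> real"
  assumes g[measurable]: "g \<in> borel_measurable borel" and eq: "AE x in lborel. f x = g x"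
  shows "integral\<^sup>L lebesgue f = integral\<^sup>L lborel g"
proof -
  have "integral\<^sup>L lebesgue f = integral\<^sup>L lebesgue g"
    using lebesgue_measurable_AE_eq[OF g eq] AE_completion[OF eq] measurable_completion[of g lborel borel]
    by (intro integral_cong_AE) auto
  also have "\<dots> = integral\<^sup>L lborel g"
    by (intro integral_completion) simp
  finally show ?thesis .
qed

text \<open>
  Lebesgue measure on a product is the completion of the product of the two Borel measures, and not
  the product of their completions, so the product-measure form of Fubini applies only to a Borel
  representative \<open>g\<close> of \<open>f\<close>. The exceptional set lies in a Borel null set, almost all of whose
  slices are null; hence \<open>f\<close> may be replaced by \<open>g\<close> in almost every inner integral.
\<close>
lemma lebesgue_Fubini:
  fixes f :: "'a::euclidean_space \<times> 'b::euclidean_space \<Rightarrow> real"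
  assumes f: "integrable lebesgue f"
  shows "(\<integral>t. (\<integral>x. f (x, t) \<partial>lebesgue) \<partial>lebesgue) = integral\<^sup>L lebesgue f"
proof -
  obtain g where g[measurable]: "g \<in> borel_measurable lborel" and eq: "AE p in lborel. f p = g p"
    using completion_ex_borel_measurable_real[OF borel_measurable_integrable[OF f]] by blast
  have int: "integrable lebesgue g"
    using integrable_cong_AE[OF borel_measurable_integrable[OF f] measurable_completion[OF g]
        AE_completion[OF eq]] f by (rule iffD1)
  then have int': "integrable lborel g"
    by (simp only: integrable_completion[OF g])
  \<comment> \<open>The exceptional set itself need not be Borel, and swapping the order of the two almost-everywhere
      quantifiers requires a Borel set.\<close>
  from eq obtain N where N: "N \<in> null_sets lborel" "{p. f p \<noteq> g p} \<subseteq> N"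
    by (auto simp: eventually_ae_filter)
  have N_sets: "N \<in> sets (lborel \<Otimes>\<^sub>M lborel)"
    using N(1) unfolding lborel_prod by auto
  have "AE p in lborel \<Otimes>\<^sub>M lborel. p \<notin> N"
    unfolding lborel_prod using N(1) by (rule AE_not_in)
  then have "AE x in lborel. AE t in lborel. (x, t) \<notin> N"
    by (rule lborel_pair.AE_pair)
  moreover have "{p \<in> space (lborel \<Otimes>\<^sub>M lborel). (fst p, snd p) \<notin> N} \<in> sets (lborel \<Otimes>\<^sub>M lborel)"
  proof -
    have "{p \<in> space (lborel \<Otimes>\<^sub>M lborel). (fst p, snd p) \<notin> N} = space (lborel \<Otimes>\<^sub>M lborel) - N"
      by auto
    then show ?thesis
      using sets.compl_sets[OF N_sets] by simp
  qed
  ultimately have "AE t in lborel. AE x in lborel. (x, t) \<notin> N"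
    by (subst (asm) lborel_pair.AE_commute)
  then have slice: "AE t in lborel. (\<integral>x. f (x, t) \<partial>lebesgue) = (\<integral>x. g (x, t) \<partial>lborel)"
  proof eventually_elim
    case (elim t)
    then have "AE x in lborel. f (x, t) = g (x, t)"
      by (rule eventually_mono) (use N(2) in auto)
    then show ?case
      by (intro lebesgue_integral_AE_eq) measurable
  qed
  have gm[measurable]: "(\<lambda>t. \<integral>x. g (x, t) \<partial>lborel) \<in> borel_measurable borel"
  proof -
    have [measurable]: "g \<in> borel_measurable (lborel \<Otimes>\<^sub>M lborel)"
      unfolding lborel_prod by (rule g)
    show ?thesis by measurable
  qed
  have "(\<integral>t. (\<integral>x. f (x, t) \<partial>lebesgue) \<partial>lebesgue) = (\<integral>t. (\<integral>x. g (x, t) \<partial>lborel) \<partial>lborel)"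
    by (rule lebesgue_integral_AE_eq[OF gm slice])
  also have "\<dots> = integral\<^sup>L lborel g"
    using lborel_pair.integral_snd[of "\<lambda>x t. g (x, t)"] int' by (simp add: lborel_prod)
  also have "\<dots> = integral\<^sup>L lebesgue f"
    using lebesgue_integral_AE_eq[of g f] g eq by simp
  finally show ?thesis .
qed

lemma lebesgue_on_Fubini:
  fixes f :: "'a::euclidean_space \<times> 'b::euclidean_space \<Rightarrow> real"
  assumes A[measurable]: "A \<in> sets borel" and B[measurable]: "B \<in> sets borel"
    and f: "integrable (lebesgue_on (A \<times> B)) f"
  shows "(\<integral>t. (\<integral>x. f (x, t) \<partial>lebesgue_on A) \<partial>lebesgue_on B) = integral\<^sup>L (lebesgue_on (A \<times> B)) f"
proof -
  have AB: "A \<times> B \<in> sets lebesgue"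
    using borel_Times[OF A B] by auto
  have "integral\<^sup>L (lebesgue_on (A \<times> B)) f = (\<integral>p. indicator (A \<times> B) p * f p \<partial>lebesgue)"
    using AB by (simp add: integral_restrict_space)
  also have "\<dots> = (\<integral>t. (\<integral>x. indicator (A \<times> B) (x, t) * f (x, t) \<partial>lebesgue) \<partial>lebesgue)"
    using f AB by (subst lebesgue_Fubini) (simp_all add: integrable_restrict_space)
  also have "\<dots> = (\<integral>t. indicator B t * (\<integral>x. indicator A x * f (x, t) \<partial>lebesgue) \<partial>lebesgue)"
    by (auto simp: indicator_times intro!: Bochner_Integration.integral_cong split: split_indicator)
  also have "\<dots> = (\<integral>t. (\<integral>x. f (x, t) \<partial>lebesgue_on A) \<partial>lebesgue_on B)"
    by (simp add: integral_restrict_space)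
  finally show ?thesis by simp
qed

text \<open>
  The classical argument: the quadratic polynomial \<open>s \<mapsto> \<integral> (f - s g)\<^sup>2\<close> is nonnegative, which at its
  vertex \<open>s = b / c\<close> is the inequality.
\<close>
lemma integral_Cauchy_Schwarz:
  fixes f g :: "'a \<Rightarrow> real"
  assumes "integrable M (\<lambda>x. (f x)\<^sup>2)" "integrable M (\<lambda>x. (g x)\<^sup>2)" "integrable M (\<lambda>x. f x * g x)"
  shows "\<bar>\<integral>x. f x * g x \<partial>M\<bar> \<le> sqrt (\<integral>x. (f x)\<^sup>2 \<partial>M) * sqrt (\<integral>x. (g x)\<^sup>2 \<partial>M)"
proof -
  define a b c where "a = (\<integral>x. (f x)\<^sup>2 \<partial>M)" and "b = (\<integral>x. f x * g x \<partial>M)" and "c = (\<integral>x. (g x)\<^sup>2 \<partial>M)"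
  have quad: "0 \<le> a - 2 * s * b + s\<^sup>2 * c" for s
  proof -
    have "0 \<le> (\<integral>x. (f x - s * g x)\<^sup>2 \<partial>M)"
      by (rule Bochner_Integration.integral_nonneg) simp
    also have "(\<lambda>x. (f x - s * g x)\<^sup>2) = (\<lambda>x. (f x)\<^sup>2 - 2 * s * (f x * g x) + s\<^sup>2 * (g x)\<^sup>2)"
      by (auto simp: power2_eq_square algebra_simps)
    also have "(\<integral>x. (f x)\<^sup>2 - 2 * s * (f x * g x) + s\<^sup>2 * (g x)\<^sup>2 \<partial>M) = a - 2 * s * b + s\<^sup>2 * c"
      using assms unfolding a_def b_def c_def by simp
    finally show ?thesis .
  qed
  have "c \<ge> 0" unfolding c_def by simp
  have "b\<^sup>2 \<le> a * c"
  proof (cases "c = 0")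
    case True
    have "b = 0"
    proof (rule ccontr)
      assume "b \<noteq> 0"
      then show False
        \<comment> \<open>For \<open>c = 0\<close> the polynomial \<open>a - 2 s b\<close> is affine; this \<open>s\<close> makes it \<open>- 1\<close>.\<close>
        using quad[of "(a + 1) / (2 * b)"] True by simp
    qed
    then show ?thesis using True by simp
  next
    case False
    then have "c > 0" using \<open>c \<ge> 0\<close> by simp
    then have "a - 2 * (b / c) * b + (b / c)\<^sup>2 * c = a - b\<^sup>2 / c"
      by (simp add: field_simps power2_eq_square)
    then have "b\<^sup>2 / c \<le> a"
      using quad[of "b / c"] by linarith
    then show ?thesis
      using \<open>c > 0\<close> by (simp add: pos_divide_le_eq)
  qed
  then have "sqrt (b\<^sup>2) \<le> sqrt (a * c)"
    by (rule real_sqrt_le_mono)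
  then show ?thesis
    unfolding a_def b_def c_def by (simp add: real_sqrt_mult)
qed

section \<open>The inner product of \<open>L\<^sup>2(\<Omega> \<times> T)\<close>\<close>

lemma L2_mult_integrable:
  assumes "u \<in> L2_space \<Omega> T" "v \<in> L2_space \<Omega> T"
  shows "integrable (lebesgue_on (\<Omega> \<times> T)) (\<lambda>p. u p * v p)"
proof (rule Bochner_Integration.integrable_bound)
  show "integrable (lebesgue_on (\<Omega> \<times> T)) (\<lambda>p. (u p)\<^sup>2 + (v p)\<^sup>2)"
    using assms by (auto simp: L2_space_def)
  show "(\<lambda>p. u p * v p) \<in> borel_measurable (lebesgue_on (\<Omega> \<times> T))"
    using assms by (auto simp: L2_space_def)
  have "\<bar>a * b\<bar> \<le> a\<^sup>2 + b\<^sup>2" for a b :: real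
  proof -
    have "2 * (\<bar>a\<bar> * \<bar>b\<bar>) \<le> a\<^sup>2 + b\<^sup>2"
      using sum_squares_bound[of "\<bar>a\<bar>" "\<bar>b\<bar>"] by simp
    moreover have "0 \<le> \<bar>a\<bar> * \<bar>b\<bar>" by simp
    ultimately show ?thesis by (simp only: abs_mult)
  qed
  then show "AE p in lebesgue_on (\<Omega> \<times> T). norm (u p * v p) \<le> norm ((u p)\<^sup>2 + (v p)\<^sup>2)"
    by simp
qed

lemma L2_space_linear_combination:
  assumes "u \<in> L2_space \<Omega> T" "v \<in> L2_space \<Omega> T"
  shows "(\<lambda>p. a * u p + b * v p) \<in> L2_space \<Omega> T"
proof -
  have sq: "(\<lambda>p. (a * u p + b * v p)\<^sup>2) = (\<lambda>p. a\<^sup>2 * (u p)\<^sup>2 + 2 * a * b * (u p * v p) + b\<^sup>2 * (v p)\<^sup>2)"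
    by (auto simp: power2_eq_square algebra_simps)
  have int: "integrable (lebesgue_on (\<Omega> \<times> T))
      (\<lambda>p. a\<^sup>2 * (u p)\<^sup>2 + 2 * a * b * (u p * v p) + b\<^sup>2 * (v p)\<^sup>2)"
    using L2_mult_integrable[OF assms] L2_mult_integrable[OF assms(1,1)] L2_mult_integrable[OF assms(2,2)]
    by (simp add: power2_eq_square)
  have meas: "(\<lambda>p. a * u p + b * v p) \<in> borel_measurable (lebesgue_on (\<Omega> \<times> T))"
    using assms unfolding L2_space_def
    by (intro borel_measurable_add borel_measurable_times borel_measurable_const) blast+
  show ?thesis
    unfolding L2_space_def mem_Collect_eq sq using meas int by (rule conjI)
qed

text \<open>
  The inner product is defined as an iterated integral; only in its joint form do linearity,
  Cauchy--Schwarz and definiteness become visible.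
\<close>
lemma L2_inner_eq_integral:
  assumes "\<Omega> \<in> sets borel" "T \<in> sets borel" "u \<in> L2_space \<Omega> T" "v \<in> L2_space \<Omega> T"
  shows "L2_inner \<Omega> T u v = (\<integral>p. u p * v p \<partial>lebesgue_on (\<Omega> \<times> T))"
  unfolding L2_inner_def
  by (rule lebesgue_on_Fubini[OF assms(1,2) L2_mult_integrable[OF assms(3,4)]])

lemma L2_norm_eq:
  assumes "\<Omega> \<in> sets borel" "T \<in> sets borel" "u \<in> L2_space \<Omega> T"
  shows "L2_norm \<Omega> T u = sqrt (\<integral>p. (u p)\<^sup>2 \<partial>lebesgue_on (\<Omega> \<times> T))"
  unfolding L2_norm_def L2_inner_eq_integral[OF assms assms(3)] by (simp add: power2_eq_square)

lemma L2_Cauchy_Schwarz: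
  assumes "\<Omega> \<in> sets borel" "T \<in> sets borel" "u \<in> L2_space \<Omega> T" "v \<in> L2_space \<Omega> T"
  shows "\<bar>L2_inner \<Omega> T u v\<bar> \<le> L2_norm \<Omega> T u * L2_norm \<Omega> T v"
  using assms integral_Cauchy_Schwarz[OF _ _ L2_mult_integrable[OF assms(3,4)]]
  by (simp add: L2_inner_eq_integral L2_norm_eq) (simp add: L2_space_def)

lemma L2_inner_linear_right:
  assumes "\<Omega> \<in> sets borel" "T \<in> sets borel"
    and "w \<in> L2_space \<Omega> T" "u \<in> L2_space \<Omega> T" "v \<in> L2_space \<Omega> T"
  shows "L2_inner \<Omega> T w (\<lambda>p. a * u p + b * v p) = a * L2_inner \<Omega> T w u + b * L2_inner \<Omega> T w v"
proof -
  have "(\<integral>p. w p * (a * u p + b * v p) \<partial>lebesgue_on (\<Omega> \<times> T))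
      = (\<integral>p. a * (w p * u p) + b * (w p * v p) \<partial>lebesgue_on (\<Omega> \<times> T))"
    by (simp add: algebra_simps)
  then show ?thesis
    using assms by (simp add: L2_inner_eq_integral L2_space_linear_combination L2_mult_integrable)
qed

lemma L2_inner_commute: "L2_inner \<Omega> T u v = L2_inner \<Omega> T v u"
  by (simp add: L2_inner_def mult.commute)

lemma L2_inner_self_zero_AE:
  assumes "\<Omega> \<in> sets borel" "T \<in> sets borel" "u \<in> L2_space \<Omega> T" "L2_inner \<Omega> T u u = 0"
  shows "AE p in lebesgue_on (\<Omega> \<times> T). u p = 0"
proof -
  have "(\<integral>p. (u p)\<^sup>2 \<partial>lebesgue_on (\<Omega> \<times> T)) = 0"
    using assms by (simp add: L2_inner_eq_integral power2_eq_square)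
  then have "AE p in lebesgue_on (\<Omega> \<times> T). (u p)\<^sup>2 = 0"
    using assms(3) by (subst (asm) integral_nonneg_eq_0_iff_AE) (auto simp: L2_space_def)
  then show ?thesis by simp
qed

lemma finite_measure_lebesgue_on_bounded_Times:
  assumes "\<Omega> \<in> sets borel" "bounded \<Omega>" "T \<in> sets borel" "bounded T"
  shows "finite_measure (lebesgue_on (\<Omega> \<times> T))"
  using assms borel_Times[of \<Omega> T]
  by (intro finite_measure_lebesgue_on bounded_set_imp_lmeasurable bounded_Times) auto

lemma bounded_measurable_in_L2_space:
  assumes "\<Omega> \<in> sets borel" "bounded \<Omega>" "T \<in> sets borel" "bounded T"
    and u: "u \<in> borel_measurable (lebesgue_on (\<Omega> \<times> T))"
    and "\<And>p. p \<in> \<Omega> \<times> T \<Longrightarrow> \<bar>u p\<bar> \<le> K"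
  shows "u \<in> L2_space \<Omega> T"
proof -
  interpret finite_measure "lebesgue_on (\<Omega> \<times> T)"
    using assms by (intro finite_measure_lebesgue_on_bounded_Times)
  have "integrable (lebesgue_on (\<Omega> \<times> T)) (\<lambda>p. (u p)\<^sup>2)"
    using assms(6) u
    by (intro integrable_const_bound[where B="K\<^sup>2"] AE_I2)
       (auto simp: space_restrict_space abs_le_square_iff[symmetric] intro: order_trans[OF _ abs_ge_self])
  then show ?thesis
    using u by (simp add: L2_space_def)
qed

lemma L2_inner_finite_sum_right:
  assumes "\<Omega> \<in> sets borel" "T \<in> sets borel" "u \<in> L2_space \<Omega> T"
    and "finite S" "\<And>k. k \<in> S \<Longrightarrow> g k \<in> L2_space \<Omega> T"
  shows "(\<lambda>p. \<Sum>k\<in>S. c k * g k p) \<in> L2_space \<Omega> T \<and>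
    L2_inner \<Omega> T u (\<lambda>p. \<Sum>k\<in>S. c k * g k p) = (\<Sum>k\<in>S. c k * L2_inner \<Omega> T u (g k))"
  using assms(4,5)
proof (induction S rule: finite_induct)
  case empty
  then show ?case by (simp add: L2_space_def L2_inner_def)
next
  case (insert k S)
  let ?v = "\<lambda>p. \<Sum>k\<in>S. c k * g k p"
  have gk: "g k \<in> L2_space \<Omega> T" and v: "?v \<in> L2_space \<Omega> T"
    and v_inner: "L2_inner \<Omega> T u ?v = (\<Sum>k\<in>S. c k * L2_inner \<Omega> T u (g k))"
    using insert.IH insert.prems by auto
  have eq: "(\<lambda>p. \<Sum>k\<in>insert k S. c k * g k p) = (\<lambda>p. c k * g k p + 1 * ?v p)"
    using insert.hyps by simp
  show ?case
    unfolding eq L2_inner_linear_right[OF assms(1-3) gk v] v_inner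
    using L2_space_linear_combination[OF gk v, of "c k" 1]
    by (rule conjI) (simp add: insert.hyps)
qed

section \<open>Operators with components represented by elements of \<open>L\<^sup>2\<close>\<close>

text \<open>
  Each component of the observation operator is the inner product with a fixed element of \<open>L\<^sup>2\<close>.
  Boundedness and adjoint are properties of all operators \<open>u \<mapsto> (\<langle>g k, u\<rangle>)\<^sub>k\<close> of this form, and this
  estimate also controls the norm of a difference of two of them.
\<close>
lemma L2_inner_vector_norm_le:
  assumes "\<Omega> \<in> sets borel" "T \<in> sets borel" "\<And>k. g k \<in> L2_space \<Omega> T" "u \<in> L2_space \<Omega> T"
  shows "norm (\<chi> k::'m::finite. L2_inner \<Omega> T (g k) u) \<le> (\<Sum>k\<in>UNIV. L2_norm \<Omega> T (g k)) * L2_norm \<Omega> T u"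
proof -
  have "norm (\<chi> k::'m. L2_inner \<Omega> T (g k) u) \<le> (\<Sum>k\<in>UNIV. \<bar>L2_inner \<Omega> T (g k) u\<bar>)"
    using norm_le_l1_cart[of "\<chi> k::'m. L2_inner \<Omega> T (g k) u"] by simp
  also have "\<dots> \<le> (\<Sum>k\<in>UNIV. L2_norm \<Omega> T (g k) * L2_norm \<Omega> T u)"
    by (intro sum_mono L2_Cauchy_Schwarz assms)
  finally show ?thesis
    by (simp add: sum_distrib_right)
qed

lemma L2_inner_vector_bounded:
  assumes "\<Omega> \<in> sets borel" "T \<in> sets borel" "\<And>k. g k \<in> L2_space \<Omega> T"
  shows "(\<lambda>u. \<chi> k::'m::finite. L2_inner \<Omega> T (g k) u) \<in> L2_bounded_operators \<Omega> T"
proof -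
  have add: "(\<chi> k::'m. L2_inner \<Omega> T (g k) (\<lambda>p. u p + v p))
      = (\<chi> k. L2_inner \<Omega> T (g k) u) + (\<chi> k. L2_inner \<Omega> T (g k) v)"
    if "u \<in> L2_space \<Omega> T" "v \<in> L2_space \<Omega> T" for u v
    using L2_inner_linear_right[OF assms that, of _ 1 1] by (simp add: vec_eq_iff)
  have scale: "(\<chi> k::'m. L2_inner \<Omega> T (g k) (\<lambda>p. c * u p)) = c *\<^sub>R (\<chi> k. L2_inner \<Omega> T (g k) u)"
    if "u \<in> L2_space \<Omega> T" for c u
    using L2_inner_linear_right[OF assms that that, of _ c 0] by (simp add: vec_eq_iff)
  have bound: "\<exists>K. \<forall>u\<in>L2_space \<Omega> T. norm (\<chi> k::'m. L2_inner \<Omega> T (g k) u) \<le> K * L2_norm \<Omega> T u"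
    using L2_inner_vector_norm_le[of \<Omega> T g] assms by blast
  show ?thesis
    unfolding L2_bounded_operators_def mem_Collect_eq
    by (intro conjI ballI allI) (rule add scale bound; assumption?)+
qed

lemma L2_norm_nonneg:
  assumes "\<Omega> \<in> sets borel" "T \<in> sets borel" "u \<in> L2_space \<Omega> T"
  shows "0 \<le> L2_norm \<Omega> T u"
  using assms by (simp add: L2_norm_eq)

text \<open>
  The lower bound cannot be read off the supremum before the set of quotients is known to be bounded
  above; it then comes from the zero function, whose quotient is \<open>0 / 0 = 0\<close>.
\<close>
lemma L2_onorm_bounds:
  fixes A :: "(st_point \<Rightarrow> real) \<Rightarrow> real ^ 'm"
  assumes "\<Omega> \<in> sets borel" "T \<in> sets borel" "0 \<le> K"
    and "\<And>u. u \<in> L2_space \<Omega> T \<Longrightarrow> norm (A u) \<le> K * L2_norm \<Omega> T u"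
  shows "0 \<le> L2_onorm \<Omega> T A" "L2_onorm \<Omega> T A \<le> K"
proof -
  have zero: "(\<lambda>_. 0) \<in> L2_space \<Omega> T"
    by (simp add: L2_space_def)
  have le: "norm (A u) / L2_norm \<Omega> T u \<le> K" if "u \<in> L2_space \<Omega> T" for u
  proof (cases "L2_norm \<Omega> T u = 0")
    case True
    then show ?thesis using assms(3) by simp
  next
    case False
    then show ?thesis
      using assms(4)[OF that] L2_norm_nonneg[OF assms(1,2) that] by (simp add: divide_le_eq)
  qed
  have "norm (A (\<lambda>_. 0)) / L2_norm \<Omega> T (\<lambda>_. 0) \<le> L2_onorm \<Omega> T A"
    unfolding L2_onorm_def
    by (rule cSUP_upper[OF zero bdd_aboveI2[of _ _ K]]) (rule le)
  then show "0 \<le> L2_onorm \<Omega> T A"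
    by (simp add: L2_norm_def L2_inner_def)
  show "L2_onorm \<Omega> T A \<le> K"
    unfolding L2_onorm_def
  proof (rule cSUP_least)
    show "L2_space \<Omega> T \<noteq> {}"
      using zero by blast
  qed (rule le)
qed

lemma L2_inner_vector_adjoint:
  assumes "\<Omega> \<in> sets borel" "T \<in> sets borel" "\<And>k. g k \<in> L2_space \<Omega> T"
  shows "is_L2_adjoint \<Omega> T (\<lambda>u. \<chi> k::'m::finite. L2_inner \<Omega> T (g k) u) (\<lambda>y p. \<Sum>k\<in>UNIV. y $ k * g k p)"
  unfolding is_L2_adjoint_def
proof (intro allI conjI ballI)
  fix y :: "real ^ 'm"
  note sum_rule = L2_inner_finite_sum_right[OF assms(1,2) _ finite assms(3), where c="\<lambda>k. y $ k" and S=UNIV]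
  have "(\<lambda>_. 0) \<in> L2_space \<Omega> T"
    by (simp add: L2_space_def)
  from conjunct1[OF sum_rule[OF this]]
  show "(\<lambda>p. \<Sum>k\<in>UNIV. y $ k * g k p) \<in> L2_space \<Omega> T" .
  fix u assume u: "u \<in> L2_space \<Omega> T"
  have "(\<chi> k. L2_inner \<Omega> T (g k) u) \<bullet> y = (\<Sum>k\<in>UNIV. y $ k * L2_inner \<Omega> T (g k) u)"
    by (simp add: inner_vec_def mult.commute)
  also have "\<dots> = (\<Sum>k\<in>UNIV. y $ k * L2_inner \<Omega> T u (g k))"
    by (simp only: L2_inner_commute[of \<Omega> T _ u])
  also have "\<dots> = L2_inner \<Omega> T u (\<lambda>p. \<Sum>k\<in>UNIV. y $ k * g k p)"
    by (rule conjunct2[OF sum_rule[OF u], symmetric])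
  finally show "(\<chi> k. L2_inner \<Omega> T (g k) u) \<bullet> y = L2_inner \<Omega> T u (\<lambda>p. \<Sum>k\<in>UNIV. y $ k * g k p)" .
qed

text \<open>
  Both values have the same inner product with every \<open>u\<close>, in particular with their own difference,
  whose norm is therefore zero. This transfers an explicit formula to the representative that
  \<^const>\<open>L2_adjoint\<close> selects.
\<close>
lemma is_L2_adjoint_unique:
  assumes "\<Omega> \<in> sets borel" "T \<in> sets borel" "is_L2_adjoint \<Omega> T A A'" "is_L2_adjoint \<Omega> T A A''"
  shows "AE p in lebesgue_on (\<Omega> \<times> T). A' y p = A'' y p"
proof -
  have L2: "A' y \<in> L2_space \<Omega> T" "A'' y \<in> L2_space \<Omega> T"
    using assms(3,4) unfolding is_L2_adjoint_def by simp_all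
  have inner: "L2_inner \<Omega> T u (A' y) = L2_inner \<Omega> T u (A'' y)" if "u \<in> L2_space \<Omega> T" for u
  proof -
    have "A u \<bullet> y = L2_inner \<Omega> T u (A' y)" "A u \<bullet> y = L2_inner \<Omega> T u (A'' y)"
      using assms(3,4) that unfolding is_L2_adjoint_def by simp_all
    then show ?thesis by simp
  qed
  let ?d = "\<lambda>p. 1 * A' y p + (- 1) * A'' y p"
  have d: "?d \<in> L2_space \<Omega> T"
    by (rule L2_space_linear_combination[OF L2])
  have "L2_inner \<Omega> T ?d ?d = 0"
    unfolding L2_inner_linear_right[OF assms(1,2) d L2] inner[OF d] by simp
  from L2_inner_self_zero_AE[OF assms(1,2) d this] show ?thesis
    by (rule eventually_mono) simp
qed

section \<open>Continuity from continuous partial derivatives\<close>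

text \<open>
  Continuity in each coordinate separately would not suffice. But near \<open>x0\<close> the partial derivatives
  are bounded by some \<open>M\<close>, so that \<open>f\<close> is \<open>M\<close>-Lipschitz along each axis, and \<open>x\<close> is reached from
  \<open>x0\<close> by changing one coordinate at a time.
\<close>
lemma continuous_on_of_continuous_partials:
  fixes f :: "real ^ 'n \<Rightarrow> 'b::real_normed_vector"
  assumes deriv: "\<And>i x. ((\<lambda>s. f (x + s *\<^sub>R axis i 1)) has_vector_derivative D i x) (at 0)"
    and cont: "\<And>i. continuous_on UNIV (D i)"
  shows "continuous_on UNIV f"
proof -
  have "(f \<longlongrightarrow> f x0) (at x0)" for x0
  proof -
    have "compact (\<Union>i. D i ` cball x0 1)"
      by (intro compact_UN compact_continuous_image continuous_on_subset[OF cont]) auto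
    then have "bounded (\<Union>i. D i ` cball x0 1)"
      by (rule compact_imp_bounded)
    then obtain M where "\<forall>v\<in>(\<Union>i. D i ` cball x0 1). norm v \<le> M"
      unfolding bounded_iff by blast
    then have M: "norm (D i x) \<le> M" if "x \<in> cball x0 1" for i x
      using that by blast
    have M0: "M \<ge> 0"
      using order_trans[OF norm_ge_zero M[of x0]] by simp
    have step: "norm (f (x + h *\<^sub>R axis i 1) - f x) \<le> M * \<bar>h\<bar>"
      if "x \<in> cball x0 1" "x + h *\<^sub>R axis i 1 \<in> cball x0 1" for x h i
    proof -
      let ?e = "axis i 1 :: real ^ 'n"
      have "norm (f (x + h *\<^sub>R ?e) - f (x + 0 *\<^sub>R ?e)) \<le> M * norm (h - 0)"
      proof (rule differentiable_bound[where f="\<lambda>s. f (x + s *\<^sub>R ?e)" and S="closed_segment 0 h"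
            and f'="\<lambda>s d. d *\<^sub>R D i (x + s *\<^sub>R ?e)"])
        fix s assume s: "s \<in> closed_segment 0 h"
        have "((\<lambda>d. f ((x + s *\<^sub>R ?e) + d *\<^sub>R ?e)) has_vector_derivative D i (x + s *\<^sub>R ?e)) (at (s - s))"
          using deriv[of "x + s *\<^sub>R ?e" i] by simp
        moreover have "((\<lambda>d. d - s) has_vector_derivative 1) (at s)"
          by (auto intro!: derivative_eq_intros)
        ultimately have "((\<lambda>d. f ((x + s *\<^sub>R ?e) + d *\<^sub>R ?e)) \<circ> (\<lambda>d. d - s) has_vector_derivative
            1 *\<^sub>R D i (x + s *\<^sub>R ?e)) (at s)"
          by (intro vector_diff_chain_at)
        moreover have "(\<lambda>d. f ((x + s *\<^sub>R ?e) + d *\<^sub>R ?e)) \<circ> (\<lambda>d. d - s) = (\<lambda>d. f (x + d *\<^sub>R ?e))"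
          by (auto simp: algebra_simps)
        ultimately show "((\<lambda>s. f (x + s *\<^sub>R ?e)) has_derivative (\<lambda>d. d *\<^sub>R D i (x + s *\<^sub>R ?e)))
            (at s within closed_segment 0 h)"
          by (simp add: has_vector_derivative_def has_derivative_at_withinI)
        obtain u where u: "0 \<le> u" "u \<le> 1" "s = u * h"
          using s by (auto simp: in_segment)
        have "(1 - u) *\<^sub>R x + u *\<^sub>R (x + h *\<^sub>R ?e) \<in> cball x0 1"
          using u that by (intro convexD_alt[OF convex_cball]) auto
        also have "(1 - u) *\<^sub>R x + u *\<^sub>R (x + h *\<^sub>R ?e) = x + s *\<^sub>R ?e"
          unfolding u(3) by (simp add: algebra_simps)
        finally have "norm (D i (x + s *\<^sub>R ?e)) \<le> M"
          by (rule M)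
        then show "onorm (\<lambda>d. d *\<^sub>R D i (x + s *\<^sub>R ?e)) \<le> M"
          by (intro onorm_le) (auto simp: mult.commute[of M] intro: mult_left_mono)
      qed simp_all
      then show ?thesis by simp
    qed
    have bound: "norm (f x - f x0) \<le> real CARD('n) * (M * norm (x - x0))" if x: "x \<in> cball x0 1" for x
    proof -
      define z where "z S = (\<chi> i. if i \<in> S then x $ i else x0 $ i)" for S
      have z_in: "z S \<in> cball x0 1" for S
      proof -
        have "norm (z S - x0) \<le> norm (x - x0)"
          by (rule norm_le_componentwise_cart) (simp add: z_def)
        then show ?thesis
          using x by (simp add: dist_norm norm_minus_commute)
      qed
      have "norm (f (z S) - f x0) \<le> real (card S) * (M * norm (x - x0))" if "finite S" for S
        using that
      proof (induction S rule: finite_induct)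
        case empty
        have "z {} = x0" by (simp add: z_def vec_eq_iff)
        then show ?case by simp
      next
        case (insert i S)
        have eq: "z (insert i S) = z S + (x $ i - x0 $ i) *\<^sub>R axis i 1"
          using insert by (auto simp: z_def vec_eq_iff axis_def)
        have "norm (f (z (insert i S)) - f (z S)) \<le> M * \<bar>x $ i - x0 $ i\<bar>"
          using step[OF z_in[of S], of "x $ i - x0 $ i" i] z_in[of "insert i S"] unfolding eq by blast
        also have "\<dots> \<le> M * norm (x - x0)"
          using component_le_norm_cart[of "x - x0" i] M0 by (simp add: mult_left_mono)
        finally have "norm (f (z (insert i S)) - f x0) \<le> M * norm (x - x0) + real (card S) * (M * norm (x - x0))"
          by (rule norm_diff_triangle_le[OF _ insert.IH])
        then show ?case
          using insert by (simp add: algebra_simps)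
      qed
      from this[of UNIV] show ?thesis
        by (simp add: z_def)
    qed
    have "((\<lambda>x. real CARD('n) * (M * norm (x - x0))) \<longlongrightarrow> real CARD('n) * (M * norm (x0 - x0))) (at x0)"
      by (intro tendsto_intros)
    then have "((\<lambda>x. real CARD('n) * (M * norm (x - x0))) \<longlongrightarrow> 0) (at x0)"
      by simp
    moreover have "eventually (\<lambda>x. x \<in> cball x0 1) (at x0)"
      by (rule eventually_mono[OF eventually_at_in_open'[of "ball x0 1"]]) auto
    then have "eventually (\<lambda>x. norm (f x - f x0) \<le> real CARD('n) * (M * norm (x - x0))) (at x0)"
      by (rule eventually_mono) (rule bound)
    ultimately have "((\<lambda>x. f x - f x0) \<longlongrightarrow> 0) (at x0)"
      by (rule Lim_null_comparison[rotated])
    then show ?thesis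
      by (rule LIM_zero_cancel)
  qed
  then show ?thesis
    by (simp add: continuous_on_def)
qed

section \<open>The observation kernel and its dependence on the parameter\<close>

text \<open>
  A path is only assumed to have continuous partial derivatives in the parameter; this is what makes
  the observation kernel continuous in it.
\<close>
lemma path_tendsto_parameter:
  assumes "parameterized_path \<Omega> Ty r" "t \<in> Ty"
  shows "((\<lambda>\<xi>. r t \<xi>) \<longlongrightarrow> r t \<xi>0) (at \<xi>0)"
proof -
  obtain D where D: "\<And>i \<xi>. ((\<lambda>s. r t (\<xi> + s *\<^sub>R axis i 1)) has_vector_derivative D i t \<xi>) (at 0)"
    and cont: "\<And>i. continuous_on (Ty \<times> UNIV) (\<lambda>(t, \<xi>). D i t \<xi>)"
    using assms unfolding parameterized_path_def by blast
  have "continuous_on UNIV (D i t)" for i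
  proof -
    have "continuous_on UNIV (\<lambda>\<xi>. (\<lambda>(t, \<xi>). D i t \<xi>) (t, \<xi>))"
      by (rule continuous_on_compose2[OF cont]) (use assms(2) in \<open>auto intro!: continuous_intros\<close>)
    then show ?thesis by simp
  qed
  then have "continuous_on UNIV (r t)"
    by (rule continuous_on_of_continuous_partials[of "r t" "\<lambda>i. D i t", OF D])
  then show ?thesis
    by (simp add: continuous_on_def)
qed

text \<open>
  Off the inversion interval \<open>r\<close> is arbitrary, hence possibly not measurable, and has to be cut off.
\<close>
lemma path_borel_measurable:
  assumes "parameterized_path \<Omega> Ty r" and Ty: "Ty \<in> sets borel"
  shows "(\<lambda>t. indicator Ty t *\<^sub>R r t \<xi>) \<in> borel_measurable borel"
  using assms(1) unfolding parameterized_path_def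
  by (intro borel_measurable_continuous_on_indicator[OF Ty]) auto

definition observation_kernel ::
  "real set \<Rightarrow> (real \<Rightarrow> real ^ 'N \<Rightarrow> real ^ 2) \<Rightarrow> real \<Rightarrow> real \<Rightarrow> real \<Rightarrow> real ^ 'N \<Rightarrow> st_point \<Rightarrow> real" where
  "observation_kernel Ty r \<epsilon>x \<epsilon>t tk \<xi> p = time_mollifier \<epsilon>t tk (snd p) * space_mollifier \<epsilon>x Ty r \<xi> p"

lemma observation_operator_eq:
  "observation_operator \<Omega> T Ty r \<theta> \<epsilon>x \<epsilon>t \<xi> =
     (\<lambda>u. \<chi> k. L2_inner \<Omega> T (observation_kernel Ty r \<epsilon>x \<epsilon>t (\<theta> k) \<xi>) u)"
proof -
  have "(\<lambda>(x, t). time_mollifier \<epsilon>t (\<theta> k) t * space_mollifier \<epsilon>x Ty r \<xi> (x, t))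
      = observation_kernel Ty r \<epsilon>x \<epsilon>t (\<theta> k) \<xi>" for k
    by (auto simp: observation_kernel_def)
  then show ?thesis
    by (intro ext) (simp add: observation_operator_def)
qed

lemma observation_kernel_borel_measurable:
  assumes "parameterized_path \<Omega> Ty r" and Ty[measurable]: "Ty \<in> sets borel"
  shows "observation_kernel Ty r \<epsilon>x \<epsilon>t tk \<xi> \<in> borel_measurable borel"
proof -
  note [measurable] = path_borel_measurable[OF assms, of \<xi>]
  have "observation_kernel Ty r \<epsilon>x \<epsilon>t tk \<xi> = (\<lambda>p. time_mollifier \<epsilon>t tk (snd p) *
      (indicator Ty (snd p) * (1 / (2 * pi * \<epsilon>x) *
        exp (- ((norm (fst p - indicator Ty (snd p) *\<^sub>R r (snd p) \<xi>))\<^sup>2 / (2 * \<epsilon>x))))))"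
    by (auto simp: observation_kernel_def space_mollifier_def split: split_indicator)
  moreover have "\<dots> \<in> borel_measurable (borel \<Otimes>\<^sub>M borel)"
    unfolding time_mollifier_def by measurable
  ultimately show ?thesis
    by (simp add: borel_prod)
qed

text \<open>
  The bound is uniform in the point and in the parameter. Since \<open>\<Omega> \<times> T\<close> has finite measure, it
  serves both for square integrability and as the majorant in the limit \<open>\<xi> \<rightarrow> \<xi>0\<close>.
\<close>
lemma observation_kernel_abs_le:
  assumes "\<epsilon>x > 0" "\<epsilon>t > 0"
  shows "\<bar>observation_kernel Ty r \<epsilon>x \<epsilon>t tk \<xi> p\<bar> \<le> 1 / sqrt (2 * pi * \<epsilon>t) * (1 / (2 * pi * \<epsilon>x))"
proof -
  have "0 \<le> time_mollifier \<epsilon>t tk t" "time_mollifier \<epsilon>t tk t \<le> 1 / sqrt (2 * pi * \<epsilon>t)" for t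
    using assms by (auto simp: time_mollifier_def divide_le_cancel mult_less_0_iff)
  moreover have "0 \<le> space_mollifier \<epsilon>x Ty r \<xi> p" "space_mollifier \<epsilon>x Ty r \<xi> p \<le> 1 / (2 * pi * \<epsilon>x)"
    using assms by (auto simp: space_mollifier_def divide_le_cancel mult_less_0_iff split: prod.split)
  ultimately show ?thesis
    unfolding observation_kernel_def abs_mult using assms
    by (intro mult_mono) (simp_all add: abs_of_nonneg)
qed

lemma observation_kernel_tendsto_parameter:
  assumes "parameterized_path \<Omega> Ty r" "\<epsilon>x > 0"
  shows "((\<lambda>\<xi>. observation_kernel Ty r \<epsilon>x \<epsilon>t tk \<xi> p) \<longlongrightarrow> observation_kernel Ty r \<epsilon>x \<epsilon>t tk \<xi>0 p) (at \<xi>0)"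
proof (cases "snd p \<in> Ty")
  case True
  then show ?thesis
    using assms(2) path_tendsto_parameter[OF assms(1) True, of \<xi>0]
    by (auto simp: observation_kernel_def space_mollifier_def case_prod_beta intro!: tendsto_intros)
next
  case False
  then show ?thesis
    by (simp add: observation_kernel_def space_mollifier_def case_prod_beta)
qed

lemma observation_kernel_in_L2_space:
  assumes "\<Omega> \<in> sets borel" "bounded \<Omega>" "T \<in> sets borel" "bounded T"
    and "parameterized_path \<Omega> Ty r" "Ty \<in> sets borel" "\<epsilon>x > 0" "\<epsilon>t > 0"
  shows "observation_kernel Ty r \<epsilon>x \<epsilon>t tk \<xi> \<in> L2_space \<Omega> T"
proof (rule bounded_measurable_in_L2_space[OF assms(1-4) _ observation_kernel_abs_le[OF assms(7,8)]])
  show "observation_kernel Ty r \<epsilon>x \<epsilon>t tk \<xi> \<in> borel_measurable (lebesgue_on (\<Omega> \<times> T))"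
    using observation_kernel_borel_measurable[OF assms(5,6)]
    by (intro measurable_restrict_space1 measurable_completion) simp
qed

text \<open>
  Dominated convergence: the kernel converges at every point as \<open>\<xi> \<rightarrow> \<xi>0\<close>, and all kernels share
  one constant bound on a set of finite measure. The difference is written as the linear combination
  \<open>1 * a + (- 1) * b\<close> so that the facts on linear combinations apply verbatim.
\<close>
lemma observation_kernel_L2_continuous:
  assumes "\<Omega> \<in> sets borel" "bounded \<Omega>" "T \<in> sets borel" "bounded T"
    and "parameterized_path \<Omega> Ty r" "Ty \<in> sets borel" "\<epsilon>x > 0" "\<epsilon>t > 0"
  shows "((\<lambda>\<xi> :: real ^ 'N. L2_norm \<Omega> T (\<lambda>p. 1 * observation_kernel Ty r \<epsilon>x \<epsilon>t tk \<xi> p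
      + (- 1) * observation_kernel Ty r \<epsilon>x \<epsilon>t tk \<xi>0 p)) \<longlongrightarrow> 0) (at \<xi>0)"
proof -
  let ?g = "observation_kernel Ty r \<epsilon>x \<epsilon>t tk" and ?M = "lebesgue_on (\<Omega> \<times> T)"
  define C where "C = 1 / sqrt (2 * pi * \<epsilon>t) * (1 / (2 * pi * \<epsilon>x))"
  note L2 = observation_kernel_in_L2_space[OF assms, of tk]
  interpret finite_measure ?M
    using assms by (intro finite_measure_lebesgue_on_bounded_Times)
  have diff_L2: "(\<lambda>p. 1 * ?g \<xi> p + (- 1) * ?g \<xi>0 p) \<in> L2_space \<Omega> T" for \<xi>
    by (rule L2_space_linear_combination[OF L2 L2])
  have "((\<lambda>\<xi>. \<integral>p. (1 * ?g \<xi> p + (- 1) * ?g \<xi>0 p)\<^sup>2 \<partial>?M) \<longlongrightarrow> 0) (at \<xi>0)"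
    unfolding tendsto_at_iff_sequentially comp_def
  proof (intro allI impI)
    fix X :: "nat \<Rightarrow> real ^ 'N"
    assume X: "\<forall>i. X i \<in> UNIV - {\<xi>0}" "X \<longlonglongrightarrow> \<xi>0"
    have "(\<lambda>i. \<integral>p. (1 * ?g (X i) p + (- 1) * ?g \<xi>0 p)\<^sup>2 \<partial>?M) \<longlonglongrightarrow> (\<integral>p. 0 \<partial>?M)"
    proof (rule integral_dominated_convergence[where w="\<lambda>_. (2 * C)\<^sup>2"])
      show "(\<lambda>p. (1 * ?g (X i) p + (- 1) * ?g \<xi>0 p)\<^sup>2) \<in> borel_measurable ?M" for i
        using diff_L2[of "X i"] unfolding L2_space_def by (intro borel_measurable_power) simp
      show "AE p in ?M. (\<lambda>i. (1 * ?g (X i) p + (- 1) * ?g \<xi>0 p)\<^sup>2) \<longlonglongrightarrow> 0"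
      proof (rule AE_I2)
        fix p
        have "(\<lambda>i. ?g (X i) p) \<longlonglongrightarrow> ?g \<xi>0 p"
          using observation_kernel_tendsto_parameter[OF assms(5,7), of \<epsilon>t tk p \<xi>0] X
          unfolding tendsto_at_iff_sequentially comp_def by blast
        then have "(\<lambda>i. (1 * ?g (X i) p + (- 1) * ?g \<xi>0 p)\<^sup>2) \<longlonglongrightarrow> (1 * ?g \<xi>0 p + (- 1) * ?g \<xi>0 p)\<^sup>2"
          by (intro tendsto_intros)
        then show "(\<lambda>i. (1 * ?g (X i) p + (- 1) * ?g \<xi>0 p)\<^sup>2) \<longlonglongrightarrow> 0"
          by simp
      qed
      show "AE p in ?M. norm ((1 * ?g (X i) p + (- 1) * ?g \<xi>0 p)\<^sup>2) \<le> (2 * C)\<^sup>2" for i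
      proof (rule AE_I2)
        fix p
        have "\<bar>?g (X i) p - ?g \<xi>0 p\<bar> \<le> \<bar>?g (X i) p\<bar> + \<bar>?g \<xi>0 p\<bar>"
          by (rule abs_triangle_ineq4)
        also have "\<dots> \<le> 2 * C"
          using observation_kernel_abs_le[OF assms(7,8), of Ty r tk _ p]
          unfolding C_def by (simp only: mult_2 add_mono)
        finally have "(?g (X i) p - ?g \<xi>0 p)\<^sup>2 \<le> (2 * C)\<^sup>2"
          by (metis abs_ge_zero power2_abs power_mono)
        then show "norm ((1 * ?g (X i) p + (- 1) * ?g \<xi>0 p)\<^sup>2) \<le> (2 * C)\<^sup>2"
          by simp
      qed
    qed simp_all
    then show "(\<lambda>i. \<integral>p. (1 * ?g (X i) p + (- 1) * ?g \<xi>0 p)\<^sup>2 \<partial>?M) \<longlonglongrightarrow> 0"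
      by simp
  qed
  from tendsto_real_sqrt[OF this] show ?thesis
    unfolding L2_norm_eq[OF assms(1,3) diff_L2] by simp
qed

text \<open>
  The difference of two observation operators again has components \<open>\<langle>d k, \<cdot>\<rangle>\<close>, with \<open>d k\<close> the
  difference of the kernels, so its operator norm is at most the sum of the norms of the \<open>d k\<close>.
\<close>
lemma observation_operator_continuous:
  fixes \<theta> :: "'m::finite \<Rightarrow> real"
  assumes "\<Omega> \<in> sets borel" "bounded \<Omega>" "T \<in> sets borel" "bounded T"
    and "parameterized_path \<Omega> Ty r" "Ty \<in> sets borel" "\<epsilon>x > 0" "\<epsilon>t > 0"
  shows "((\<lambda>\<xi>. L2_onorm \<Omega> T (\<lambda>u. observation_operator \<Omega> T Ty r \<theta> \<epsilon>x \<epsilon>t \<xi> u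
      - observation_operator \<Omega> T Ty r \<theta> \<epsilon>x \<epsilon>t \<xi>0 u)) \<longlongrightarrow> 0) (at \<xi>0)"
proof -
  let ?g = "\<lambda>k. observation_kernel Ty r \<epsilon>x \<epsilon>t (\<theta> k)"
  let ?d = "\<lambda>\<xi> k p. 1 * ?g k \<xi> p + (- 1) * ?g k \<xi>0 p"
  let ?A = "\<lambda>\<xi> u. observation_operator \<Omega> T Ty r \<theta> \<epsilon>x \<epsilon>t \<xi> u
      - observation_operator \<Omega> T Ty r \<theta> \<epsilon>x \<epsilon>t \<xi>0 u"
  note L2 = observation_kernel_in_L2_space[OF assms]
  have d: "?d \<xi> k \<in> L2_space \<Omega> T" for \<xi> k
    by (rule L2_space_linear_combination[OF L2 L2])
  have K: "0 \<le> (\<Sum>k\<in>UNIV. L2_norm \<Omega> T (?d \<xi> k))" for \<xi>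
    by (intro sum_nonneg L2_norm_nonneg assms d)
  have "norm (?A \<xi> u) \<le> (\<Sum>k\<in>UNIV. L2_norm \<Omega> T (?d \<xi> k)) * L2_norm \<Omega> T u"
    if u: "u \<in> L2_space \<Omega> T" for \<xi> u
  proof -
    have "?A \<xi> u = (\<chi> k. L2_inner \<Omega> T (?d \<xi> k) u)"
    proof (rule vec_eq_iff[THEN iffD2], rule allI)
      fix k
      have "L2_inner \<Omega> T (?d \<xi> k) u = 1 * L2_inner \<Omega> T u (?g k \<xi>) + (- 1) * L2_inner \<Omega> T u (?g k \<xi>0)"
        unfolding L2_inner_commute[of \<Omega> T "?d \<xi> k"]
        by (rule L2_inner_linear_right[OF assms(1,3) u L2 L2])
      then show "?A \<xi> u $ k = (\<chi> k. L2_inner \<Omega> T (?d \<xi> k) u) $ k"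
        unfolding observation_operator_eq by (simp add: L2_inner_commute[of \<Omega> T _ u])
    qed
    then show ?thesis
      using L2_inner_vector_norm_le[of \<Omega> T "?d \<xi>" u] assms(1,3) d u by simp
  qed
  note bounds = L2_onorm_bounds[OF assms(1,3) K this]
  have "((\<lambda>\<xi>. \<Sum>k\<in>UNIV. L2_norm \<Omega> T (?d \<xi> k)) \<longlongrightarrow> (\<Sum>k\<in>(UNIV::'m set). 0)) (at \<xi>0)"
    by (intro tendsto_sum observation_kernel_L2_continuous assms)
  then have majorant: "((\<lambda>\<xi>. \<Sum>k\<in>UNIV. L2_norm \<Omega> T (?d \<xi> k)) \<longlongrightarrow> 0) (at \<xi>0)"
    by simp
  have lower: "\<forall>\<^sub>F \<xi> in at \<xi>0. 0 \<le> L2_onorm \<Omega> T (?A \<xi>)"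
    by (rule always_eventually) (rule allI, rule bounds(1))
  have upper: "\<forall>\<^sub>F \<xi> in at \<xi>0. L2_onorm \<Omega> T (?A \<xi>) \<le> (\<Sum>k\<in>UNIV. L2_norm \<Omega> T (?d \<xi> k))"
    by (rule always_eventually) (rule allI, rule bounds(2))
  show ?thesis
    by (rule tendsto_sandwich[OF lower upper tendsto_const majorant])
qed

text \<open>
  The adjoint of \<open>u \<mapsto> (\<langle>g k, u\<rangle>)\<^sub>k\<close> is \<open>y \<mapsto> \<Sum>k. y $ k * g k\<close>; here the spatial factor is common to
  all \<open>g k\<close> and leaves the sum.
\<close>
lemma observation_operator_adjoint:
  fixes \<theta> :: "'m::finite \<Rightarrow> real" and \<xi> :: "real ^ 'N"
  assumes "\<Omega> \<in> sets borel" "bounded \<Omega>" "T \<in> sets borel" "bounded T"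
    and "parameterized_path \<Omega> Ty r" "Ty \<in> sets borel" "\<epsilon>x > 0" "\<epsilon>t > 0"
  defines "B \<equiv> observation_operator \<Omega> T Ty r \<theta> \<epsilon>x \<epsilon>t \<xi>"
  shows "is_L2_adjoint \<Omega> T B (L2_adjoint \<Omega> T B)"
    and "AE (x, t) in lebesgue_on (\<Omega> \<times> T). L2_adjoint \<Omega> T B y (x, t)
           = space_mollifier \<epsilon>x Ty r \<xi> (x, t) * (\<Sum>k\<in>UNIV. time_mollifier \<epsilon>t (\<theta> k) t * y $ k)"
proof -
  let ?g = "\<lambda>k. observation_kernel Ty r \<epsilon>x \<epsilon>t (\<theta> k) \<xi>"
  have ex: "is_L2_adjoint \<Omega> T B (\<lambda>y p. \<Sum>k\<in>UNIV. y $ k * ?g k p)"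
    unfolding B_def observation_operator_eq
    by (intro L2_inner_vector_adjoint observation_kernel_in_L2_space assms)
  then show adj: "is_L2_adjoint \<Omega> T B (L2_adjoint \<Omega> T B)"
    unfolding L2_adjoint_def by (rule someI[of "is_L2_adjoint \<Omega> T B"])
  have "(\<Sum>k\<in>UNIV. y $ k * ?g k p) =
      space_mollifier \<epsilon>x Ty r \<xi> p * (\<Sum>k\<in>UNIV. time_mollifier \<epsilon>t (\<theta> k) (snd p) * y $ k)" for p
    unfolding observation_kernel_def sum_distrib_left by (intro sum.cong) simp_all
  with is_L2_adjoint_unique[OF assms(1,3) adj ex, of y]
  show "AE (x, t) in lebesgue_on (\<Omega> \<times> T). L2_adjoint \<Omega> T B y (x, t)
           = space_mollifier \<epsilon>x Ty r \<xi> (x, t) * (\<Sum>k\<in>UNIV. time_mollifier \<epsilon>t (\<theta> k) t * y $ k)"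
    by (simp add: case_prod_beta)
qed

section \<open>Averages against the standard Gaussian\<close>

text \<open>
  The general dimension allows the same facts to serve for the mollifiers in space and in time.
\<close>
definition std_gaussian :: "'a::euclidean_space \<Rightarrow> real" where
  "std_gaussian y = (1 / sqrt (2 * pi)) ^ DIM('a) * exp (- ((norm y)\<^sup>2 / 2))"

lemma std_gaussian_nonneg: "0 \<le> std_gaussian y"
  by (simp add: std_gaussian_def)

lemma std_gaussian_measurable[measurable]: "std_gaussian \<in> borel_measurable borel"
  unfolding std_gaussian_def[abs_def] by measurable

text \<open>
  The density is the product of one-dimensional normal densities over the coordinates.
\<close>
lemma has_integral_std_gaussian:
  "has_bochner_integral lborel (std_gaussian :: 'a::euclidean_space \<Rightarrow> real) 1"
proof (rule has_bochner_integral_nn_integral)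
  have prod: "std_gaussian y = (\<Prod>b\<in>Basis. std_normal_density (y \<bullet> b))" for y :: 'a
  proof -
    have "(norm y)\<^sup>2 = (\<Sum>b\<in>Basis. (y \<bullet> b)\<^sup>2)"
      by (simp add: norm_eq_sqrt_inner euclidean_inner[of y y] power2_eq_square sum_nonneg)
    then have "exp (- ((norm y)\<^sup>2 / 2)) = exp (\<Sum>b\<in>Basis. - ((y \<bullet> b)\<^sup>2 / 2))"
      by (simp add: sum_negf sum_divide_distrib)
    also have "\<dots> = (\<Prod>b\<in>Basis. exp (- ((y \<bullet> b)\<^sup>2 / 2)))"
      by (rule exp_sum) simp
    finally show ?thesis
      by (simp add: std_gaussian_def std_normal_density_def prod_dividef power_one_over)
  qed
  have "(\<integral>\<^sup>+ y. ennreal (std_gaussian (y::'a)) \<partial>lborel)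
      = (\<integral>\<^sup>+ y. (\<Prod>b\<in>Basis. ennreal (std_normal_density ((y::'a) \<bullet> b))) \<partial>lborel)"
    by (simp add: prod prod_ennreal)
  also have "\<dots> = (\<Prod>b\<in>(Basis::'a set). \<integral>\<^sup>+ z. ennreal (std_normal_density z) \<partial>lborel)"
    by (subst nn_integral_lborel_prod) simp_all
  also have "(\<integral>\<^sup>+ z. ennreal (std_normal_density z) \<partial>lborel) = 1"
    by (subst nn_integral_eq_integral) simp_all
  finally show "(\<integral>\<^sup>+ y. ennreal (std_gaussian (y::'a)) \<partial>lborel) = ennreal 1"
    by simp
qed (simp_all add: std_gaussian_nonneg)

lemma integrable_std_gaussian: "integrable lborel (std_gaussian :: 'a::euclidean_space \<Rightarrow> real)"
  and integral_std_gaussian: "integral\<^sup>L lborel (std_gaussian :: 'a::euclidean_space \<Rightarrow> real) = 1"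
  using has_integral_std_gaussian[where 'a='a] by (simp_all add: has_bochner_integral_iff)

text \<open>
  The substitution \<open>x = c + \<sigma> y\<close> moves the concentration of the Gaussian into the argument of \<open>f\<close>:
  the weight becomes fixed, and a limit \<open>\<sigma> \<rightarrow> 0\<close> becomes one of integrands against a fixed
  probability density.
\<close>
lemma std_gaussian_rescale:
  fixes f :: "'a::euclidean_space \<Rightarrow> real"
  assumes [measurable]: "f \<in> borel_measurable borel" and "0 < \<sigma>"
  shows "(\<integral>x. std_gaussian ((1 / \<sigma>) *\<^sub>R (x - c)) / \<sigma> ^ DIM('a) * f x \<partial>lborel)
       = (\<integral>y. std_gaussian y * f (c + \<sigma> *\<^sub>R y) \<partial>lborel)"
proof -
  let ?F = "\<lambda>x. std_gaussian ((1 / \<sigma>) *\<^sub>R (x - c)) / \<sigma> ^ DIM('a) * f x"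
  have "integral\<^sup>L lborel ?F
      = integral\<^sup>L (density (distr lborel borel (\<lambda>x. c + \<sigma> *\<^sub>R x)) (\<lambda>_. ennreal (\<bar>\<sigma>\<bar> ^ DIM('a)))) ?F"
    using assms(2) by (subst lborel_affine[of \<sigma> c]) simp_all
  also have "\<dots> = (\<integral>y. \<bar>\<sigma>\<bar> ^ DIM('a) *\<^sub>R ?F (c + \<sigma> *\<^sub>R y) \<partial>lborel)"
    by (subst integral_density; (subst integral_distr)?) simp_all
  also have "\<dots> = (\<integral>y. std_gaussian y * f (c + \<sigma> *\<^sub>R y) \<partial>lborel)"
    using assms(2) by simp
  finally show ?thesis .
qed

lemma std_gaussian_average_bound:
  fixes f :: "'a::euclidean_space \<Rightarrow> real"
  assumes "\<And>y. \<bar>f y\<bar> \<le> M"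
  shows "\<bar>\<integral>y. std_gaussian y * f y \<partial>lborel\<bar> \<le> M"
proof -
  have "\<bar>\<integral>y. std_gaussian y * f y \<partial>lborel\<bar> \<le> (\<integral>y. \<bar>std_gaussian y * f y\<bar> \<partial>lborel)"
    by (rule integral_abs_bound)
  also have "\<dots> \<le> (\<integral>y. std_gaussian (y::'a) * M \<partial>lborel)"
    using assms order_trans[OF abs_ge_zero assms]
    by (intro integral_mono') (auto simp: abs_mult std_gaussian_nonneg integrable_std_gaussian intro!: mult_left_mono)
  also have "\<dots> = M"
    by (simp add: integral_std_gaussian)
  finally show ?thesis .
qed

lemma std_gaussian_average_tendsto:
  fixes f :: "nat \<Rightarrow> 'a::euclidean_space \<Rightarrow> real"
  assumes [measurable]: "\<And>n. f n \<in> borel_measurable borel"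
    and "\<And>n y. \<bar>f n y\<bar> \<le> M" and "\<And>y. (\<lambda>n. f n y) \<longlonglongrightarrow> v"
  shows "(\<lambda>n. \<integral>y. std_gaussian y * f n y \<partial>lborel) \<longlonglongrightarrow> v"
proof -
  have "(\<lambda>n. \<integral>y. std_gaussian y * f n y \<partial>lborel) \<longlonglongrightarrow> (\<integral>y. std_gaussian (y::'a) * v \<partial>lborel)"
  proof (rule integral_dominated_convergence[where w="\<lambda>y. std_gaussian y * M"])
    show "AE y in lborel. norm (std_gaussian y * f n y) \<le> std_gaussian y * M" for n
      using assms(2) by (auto simp: abs_mult std_gaussian_nonneg intro!: mult_left_mono AE_I2)
    show "AE y in lborel. (\<lambda>n. std_gaussian y * f n y) \<longlonglongrightarrow> std_gaussian y * v"
      using assms(3) by (auto intro!: tendsto_intros AE_I2)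
  qed (simp_all add: integrable_std_gaussian)
  then show ?thesis
    by (simp add: integral_std_gaussian)
qed

lemma space_mollifier_eq_gaussian:
  assumes "0 < \<epsilon>x" "t \<in> Ty"
  shows "space_mollifier \<epsilon>x Ty r \<xi> (x, t)
    = std_gaussian ((1 / sqrt \<epsilon>x) *\<^sub>R (x - r t \<xi>)) / sqrt \<epsilon>x ^ DIM(real ^ 2)"
proof -
  have "(norm ((1 / sqrt \<epsilon>x) *\<^sub>R (x - r t \<xi>)))\<^sup>2 = (norm (x - r t \<xi>))\<^sup>2 / \<epsilon>x"
    using assms(1) by (simp add: power_divide)
  then show ?thesis
    using assms by (simp add: space_mollifier_def std_gaussian_def power_divide)
qed

lemma time_mollifier_eq_gaussian:
  assumes "0 < \<epsilon>t"
  shows "time_mollifier \<epsilon>t tk t = std_gaussian ((1 / sqrt \<epsilon>t) *\<^sub>R (t - tk)) / sqrt \<epsilon>t ^ DIM(real)"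
  using assms by (simp add: time_mollifier_def std_gaussian_def real_sqrt_mult power_divide field_simps)

section \<open>The limit of vanishing mollification\<close>

text \<open>
  The change of variables moves the argument of \<open>u\<close> over the whole space, which requires a globally
  defined Borel function in place of \<open>u\<close>.
\<close>
lemma zero_extension_measurable:
  fixes u :: "'a::euclidean_space \<times> 'b::euclidean_space \<Rightarrow> real"
  assumes "A \<in> sets borel" "C \<in> sets borel" "C \<subseteq> B" "continuous_on (A \<times> B) u"
  shows "(\<lambda>p. indicator (A \<times> C) p * u p) \<in> borel_measurable borel"
proof -
  have "(\<lambda>p. indicator (A \<times> C) p *\<^sub>R u p) \<in> borel_measurable borel"
    using assms
    by (intro borel_measurable_continuous_on_indicator borel_Times continuous_on_subset[OF assms(4)]) auto
  then show ?thesis by simp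
qed

lemma std_gaussian_translate_average_measurable:
  fixes w :: "'a::euclidean_space \<times> 'b::euclidean_space \<Rightarrow> real"
  assumes "w \<in> borel_measurable borel" and [measurable]: "\<rho> \<in> borel_measurable borel"
  shows "(\<lambda>t. \<integral>y. std_gaussian y * w (\<rho> t + \<sigma> *\<^sub>R y, t) \<partial>lborel) \<in> borel_measurable borel"
proof -
  have [measurable]: "w \<in> borel_measurable (borel \<Otimes>\<^sub>M borel)"
    using assms(1) by (simp add: borel_prod)
  show ?thesis by measurable
qed

text \<open>
  The substitutions \<open>x = \<rho> t + sqrt \<epsilon>x y\<close> and \<open>t = tk + sqrt \<epsilon>t s\<close> turn the mollified value of
  \<open>u\<close> into a standard Gaussian average. The cut-off in \<open>w\<close> encodes both that the integral in space
  is over \<open>\<Omega>\<close> only and that the spatial mollifier vanishes for times outside \<open>Ty\<close>.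
\<close>
lemma L2_inner_observation_kernel_rescaled:
  fixes u :: "st_point \<Rightarrow> real" and \<xi> :: "real ^ 'N"
  assumes [measurable]: "\<Omega> \<in> sets borel" "T \<in> sets borel" "Ty \<in> sets borel" and "Ty \<subseteq> T"
    and path: "parameterized_path \<Omega> Ty r" and u: "continuous_on (\<Omega> \<times> T) u"
    and \<epsilon>: "0 < \<epsilon>x" "0 < \<epsilon>t"
  defines "w \<equiv> \<lambda>p. indicator (\<Omega> \<times> Ty) p * u p"
    and "\<rho> \<equiv> \<lambda>t. indicator Ty t *\<^sub>R r t \<xi>"
  shows "L2_inner \<Omega> T (observation_kernel Ty r \<epsilon>x \<epsilon>t tk \<xi>) u
    = (\<integral>s. std_gaussian s * (\<integral>y. std_gaussian y *
         w (\<rho> (tk + sqrt \<epsilon>t *\<^sub>R s) + sqrt \<epsilon>x *\<^sub>R y, tk + sqrt \<epsilon>t *\<^sub>R s) \<partial>lborel) \<partial>lborel)"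
proof -
  have w[measurable]: "w \<in> borel_measurable borel"
    unfolding w_def using assms(1,3,4) u by (rule zero_extension_measurable)
  have \<rho>[measurable]: "\<rho> \<in> borel_measurable borel"
    unfolding \<rho>_def by (rule path_borel_measurable[OF path]) simp
  define G where "G t = (\<integral>y. std_gaussian y * w (\<rho> t + sqrt \<epsilon>x *\<^sub>R y, t) \<partial>lborel)" for t
  have G[measurable]: "G \<in> borel_measurable borel"
    unfolding G_def[abs_def] by (rule std_gaussian_translate_average_measurable[OF w \<rho>])
  have time[measurable]: "time_mollifier \<epsilon>t tk \<in> borel_measurable borel"
    unfolding time_mollifier_def[abs_def] by measurable
  have inner: "(\<integral>x. observation_kernel Ty r \<epsilon>x \<epsilon>t tk \<xi> (x, t) * u (x, t) \<partial>lebesgue_on \<Omega>)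
      = time_mollifier \<epsilon>t tk t * G t" for t
  proof (cases "t \<in> Ty")
    case True
    let ?F = "\<lambda>x. std_gaussian ((1 / sqrt \<epsilon>x) *\<^sub>R (x - \<rho> t)) / sqrt \<epsilon>x ^ DIM(real ^ 2) * w (x, t)"
    have "(\<integral>x. observation_kernel Ty r \<epsilon>x \<epsilon>t tk \<xi> (x, t) * u (x, t) \<partial>lebesgue_on \<Omega>)
        = (\<integral>x. indicator \<Omega> x *\<^sub>R (observation_kernel Ty r \<epsilon>x \<epsilon>t tk \<xi> (x, t) * u (x, t)) \<partial>lebesgue)"
      by (rule integral_restrict_space) simp
    also have "\<dots> = (\<integral>x. time_mollifier \<epsilon>t tk t * ?F x \<partial>lebesgue)"
      using True space_mollifier_eq_gaussian[OF \<epsilon>(1) True, of r \<xi>]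
      by (intro Bochner_Integration.integral_cong)
         (auto simp: observation_kernel_def w_def \<rho>_def split: split_indicator)
    also have "\<dots> = (\<integral>x. time_mollifier \<epsilon>t tk t * ?F x \<partial>lborel)"
      by (rule integral_completion) measurable
    also have "\<dots> = time_mollifier \<epsilon>t tk t * (\<integral>x. ?F x \<partial>lborel)"
      by simp
    also have "(\<integral>x. ?F x \<partial>lborel) = G t"
      unfolding G_def using \<epsilon> by (intro std_gaussian_rescale) simp_all
    finally show ?thesis .
  next
    case False
    then show ?thesis
      by (simp add: observation_kernel_def space_mollifier_def G_def w_def)
  qed
  have G_outside: "G t = 0" if "t \<notin> T" for t
  proof -
    have "t \<notin> Ty"
      using that \<open>Ty \<subseteq> T\<close> by blast
    then show ?thesis
      by (simp add: G_def w_def indicator_times)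
  qed
  have "L2_inner \<Omega> T (observation_kernel Ty r \<epsilon>x \<epsilon>t tk \<xi>) u
      = (\<integral>t. indicator T t *\<^sub>R (time_mollifier \<epsilon>t tk t * G t) \<partial>lebesgue)"
    unfolding L2_inner_def inner by (rule integral_restrict_space) simp
  also have "\<dots> = (\<integral>t. time_mollifier \<epsilon>t tk t * G t \<partial>lebesgue)"
    by (intro Bochner_Integration.integral_cong) (auto simp: G_outside split: split_indicator)
  also have "\<dots> = (\<integral>t. time_mollifier \<epsilon>t tk t * G t \<partial>lborel)"
    by (rule integral_completion) measurable
  also have "\<dots> = (\<integral>s. std_gaussian s * G (tk + sqrt \<epsilon>t *\<^sub>R s) \<partial>lborel)"
    unfolding time_mollifier_eq_gaussian[OF \<epsilon>(2)] using \<epsilon>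
    by (intro std_gaussian_rescale) simp_all
  finally show "L2_inner \<Omega> T (observation_kernel Ty r \<epsilon>x \<epsilon>t tk \<xi>) u
    = (\<integral>s. std_gaussian s * (\<integral>y. std_gaussian y *
         w (\<rho> (tk + sqrt \<epsilon>t *\<^sub>R s) + sqrt \<epsilon>x *\<^sub>R y, tk + sqrt \<epsilon>t *\<^sub>R s) \<partial>lborel) \<partial>lborel)"
    unfolding G_def .
qed

text \<open>
  For fixed \<open>y\<close> and \<open>s\<close> the argument of \<open>w\<close> tends to \<open>(r tk \<xi>, tk)\<close>. That point is interior to
  \<open>\<Omega> \<times> Ty\<close>, where \<open>w\<close> agrees with \<open>u\<close> on a neighbourhood; at an end point of \<open>Ty\<close> the cut-off
  would be felt in the limit, as part of the mass of the Gaussian lies beyond it. Boundedness of \<open>u\<close> gives the majorants for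
  dominated convergence, used first in space at each fixed \<open>s\<close> and then in time. Both limits are
  taken along one sequence of pairs \<open>(\<epsilon>x, \<epsilon>t)\<close>, so no relation between the two rates enters.
\<close>
lemma L2_inner_observation_kernel_tendsto:
  assumes "open \<Omega>" "T \<in> sets borel" "Ty \<in> sets borel" "Ty \<subseteq> T"
    and path: "parameterized_path \<Omega> Ty r" and u: "continuous_on (\<Omega> \<times> T) u"
    and "bounded (u ` (\<Omega> \<times> T))" and tk: "tk \<in> interior Ty"
  shows "((\<lambda>(\<epsilon>x, \<epsilon>t). L2_inner \<Omega> T (observation_kernel Ty r \<epsilon>x \<epsilon>t tk \<xi>) u)
      \<longlongrightarrow> u (r tk \<xi>, tk)) (at (0, 0) within {0<..} \<times> {0<..})"
proof -
  define w where "w p = indicator (\<Omega> \<times> Ty) p * u p" for p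
  define \<rho> where "\<rho> t = indicator Ty t *\<^sub>R r t \<xi>" for t
  define G where "G \<sigma> t = (\<integral>y. std_gaussian y * w (\<rho> t + \<sigma> *\<^sub>R y, t) \<partial>lborel)" for \<sigma> t
  have \<Omega>: "\<Omega> \<in> sets borel"
    using assms(1) by simp
  have rescaled: "L2_inner \<Omega> T (observation_kernel Ty r \<epsilon>x \<epsilon>t tk \<xi>) u
      = (\<integral>s. std_gaussian s * G (sqrt \<epsilon>x) (tk + sqrt \<epsilon>t *\<^sub>R s) \<partial>lborel)" if "0 < \<epsilon>x" "0 < \<epsilon>t" for \<epsilon>x \<epsilon>t
    unfolding G_def w_def \<rho>_def
    by (rule L2_inner_observation_kernel_rescaled[OF \<Omega> assms(2-6) that])
  have w_meas: "w \<in> borel_measurable borel"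
    unfolding w_def[abs_def] using \<Omega> assms(3,4,6) by (rule zero_extension_measurable)
  have G_meas: "G \<sigma> \<in> borel_measurable borel" for \<sigma>
    unfolding G_def[abs_def] \<rho>_def[abs_def]
    by (rule std_gaussian_translate_average_measurable[OF w_meas path_borel_measurable[OF path assms(3)]])
  obtain M where "\<forall>v\<in>u ` (\<Omega> \<times> T). norm v \<le> M"
    using assms(7) unfolding bounded_iff by blast
  then have w_bound: "\<bar>w p\<bar> \<le> \<bar>M\<bar>" for p
    using \<open>Ty \<subseteq> T\<close> by (force simp: w_def split: split_indicator)
  have tk_Ty: "tk \<in> Ty" and path_in: "r tk \<xi> \<in> \<Omega>" and path_cont: "continuous_on Ty (\<lambda>t. r t \<xi>)"
    using tk interior_subset path unfolding parameterized_path_def by blast+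
  have \<rho>_cont: "isCont \<rho> tk"
  proof -
    have "continuous_on (interior Ty) (\<lambda>t. r t \<xi>)"
      using path_cont interior_subset by (rule continuous_on_subset)
    then have "continuous_on (interior Ty) \<rho>"
      using interior_subset[of Ty] by (subst continuous_on_cong[OF refl, of _ \<rho> "\<lambda>t. r t \<xi>"]) (auto simp: \<rho>_def)
    then show ?thesis
      using tk by (simp add: continuous_on_eq_continuous_at)
  qed
  have w_cont: "isCont w (r tk \<xi>, tk)"
  proof -
    have "continuous_on (\<Omega> \<times> interior Ty) u"
      using interior_subset[of Ty] \<open>Ty \<subseteq> T\<close> by (intro continuous_on_subset[OF u]) auto
    then have "continuous_on (\<Omega> \<times> interior Ty) w"
      using interior_subset[of Ty]
      by (subst continuous_on_cong[OF refl, of _ w u]) (auto simp: w_def)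
    moreover have "open (\<Omega> \<times> interior Ty)"
      using assms(1) by (intro open_Times) auto
    ultimately show ?thesis
      using tk path_in by (simp add: continuous_on_eq_continuous_at)
  qed
  show ?thesis
    unfolding tendsto_at_iff_sequentially comp_def
  proof (intro allI impI)
    fix X :: "nat \<Rightarrow> real \<times> real"
    assume X: "\<forall>n. X n \<in> {0<..} \<times> {0<..} - {(0, 0)}" "X \<longlonglongrightarrow> (0, 0)"
    define a b where "a n = sqrt (fst (X n))" and "b n = sqrt (snd (X n))" for n
    have pos: "0 < fst (X n)" "0 < snd (X n)" for n
      using X(1) by (auto simp: mem_Times_iff)
    have a: "a \<longlonglongrightarrow> 0" and b: "b \<longlonglongrightarrow> 0"
      using tendsto_real_sqrt[OF tendsto_fst[OF X(2)]] tendsto_real_sqrt[OF tendsto_snd[OF X(2)]]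
      by (simp_all add: a_def[abs_def] b_def[abs_def])
    have G_bound: "\<bar>G \<sigma> t\<bar> \<le> \<bar>M\<bar>" for \<sigma> t
      unfolding G_def by (rule std_gaussian_average_bound) (rule w_bound)
    have G_tendsto: "(\<lambda>n. G (a n) (tk + b n *\<^sub>R s)) \<longlonglongrightarrow> u (r tk \<xi>, tk)" for s
      unfolding G_def
    proof (rule std_gaussian_average_tendsto)
      let ?t = "\<lambda>n. tk + b n *\<^sub>R s"
      show "(\<lambda>y. w (\<rho> (?t n) + a n *\<^sub>R y, ?t n)) \<in> borel_measurable borel" for n
        using w_meas by (rule measurable_compose[rotated])
          (auto intro!: borel_measurable_continuous_onI continuous_intros)
      show "\<bar>w (\<rho> (?t n) + a n *\<^sub>R y, ?t n)\<bar> \<le> \<bar>M\<bar>" for n y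
        by (rule w_bound)
      show "(\<lambda>n. w (\<rho> (?t n) + a n *\<^sub>R y, ?t n)) \<longlonglongrightarrow> u (r tk \<xi>, tk)" for y
      proof -
        have "?t \<longlonglongrightarrow> tk + 0 *\<^sub>R s"
          using b by (intro tendsto_intros)
        then have t: "?t \<longlonglongrightarrow> tk" by simp
        have "(\<lambda>n. \<rho> (?t n) + a n *\<^sub>R y) \<longlonglongrightarrow> \<rho> tk + 0 *\<^sub>R y"
          using a by (intro tendsto_intros isCont_tendsto_compose[OF \<rho>_cont t])
        then have "(\<lambda>n. \<rho> (?t n) + a n *\<^sub>R y) \<longlonglongrightarrow> r tk \<xi>"
          using tk_Ty by (simp add: \<rho>_def)
        from isCont_tendsto_compose[OF w_cont tendsto_Pair[OF this t]] show ?thesis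
          using tk_Ty path_in by (simp add: w_def)
      qed
    qed
    have "(\<lambda>n. \<integral>s. std_gaussian s * G (a n) (tk + b n *\<^sub>R s) \<partial>lborel) \<longlonglongrightarrow> u (r tk \<xi>, tk)"
    proof (rule std_gaussian_average_tendsto)
      show "(\<lambda>s. G (a n) (tk + b n *\<^sub>R s)) \<in> borel_measurable borel" for n
        using G_meas by (rule measurable_compose[rotated])
          (auto intro!: borel_measurable_continuous_onI continuous_intros)
    qed (rule G_bound G_tendsto)+
    then show "(\<lambda>n. case X n of (\<epsilon>x, \<epsilon>t) \<Rightarrow> L2_inner \<Omega> T (observation_kernel Ty r \<epsilon>x \<epsilon>t tk \<xi>) u)
        \<longlonglongrightarrow> u (r tk \<xi>, tk)"
      using pos by (simp add: case_prod_beta rescaled a_def b_def)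
  qed
qed

section \<open>Properties of the observation operator\<close>

theorem theorem1:
  fixes \<Omega> :: "(real ^ 2) set" and T Ty :: "real set"
    and r :: "real \<Rightarrow> real ^ 'N \<Rightarrow> real ^ 2"
    and \<theta> :: "'m::finite \<Rightarrow> real"
  assumes "open \<Omega>" and "bounded \<Omega>" and "convex \<Omega>"
    and "is_interval T" and "bounded T"
    and "is_interval Ty" and "Ty \<subseteq> T"
    and "parameterized_path \<Omega> Ty r"
    and "\<And>k. \<theta> k \<in> Ty"
  shows
    "(\<forall>\<xi> u k. continuous_on (\<Omega> \<times> T) u \<and> bounded (u ` (\<Omega> \<times> T)) \<and> \<theta> k \<in> interior Ty \<longrightarrow>
        ((\<lambda>(\<epsilon>x, \<epsilon>t). observation_operator \<Omega> T Ty r \<theta> \<epsilon>x \<epsilon>t \<xi> u $ k)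
          \<longlongrightarrow> u (r (\<theta> k) \<xi>, \<theta> k)) (at (0, 0) within {0<..} \<times> {0<..}))
     \<and>
     (\<forall>\<epsilon>x>0. \<forall>\<epsilon>t>0.
        (\<forall>\<xi>. observation_operator \<Omega> T Ty r \<theta> \<epsilon>x \<epsilon>t \<xi> \<in> L2_bounded_operators \<Omega> T)
        \<and>
        (\<forall>\<xi>\<^sub>0. ((\<lambda>\<xi>. L2_onorm \<Omega> T (\<lambda>u. observation_operator \<Omega> T Ty r \<theta> \<epsilon>x \<epsilon>t \<xi> u
                                     - observation_operator \<Omega> T Ty r \<theta> \<epsilon>x \<epsilon>t \<xi>\<^sub>0 u))
                \<longlongrightarrow> 0) (at \<xi>\<^sub>0))
        \<and>
        (\<forall>\<xi>. is_L2_adjoint \<Omega> T (observation_operator \<Omega> T Ty r \<theta> \<epsilon>x \<epsilon>t \<xi>)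
                (L2_adjoint \<Omega> T (observation_operator \<Omega> T Ty r \<theta> \<epsilon>x \<epsilon>t \<xi>)) \<and>
             (\<forall>y. AE (x, t) in lebesgue_on (\<Omega> \<times> T).
                L2_adjoint \<Omega> T (observation_operator \<Omega> T Ty r \<theta> \<epsilon>x \<epsilon>t \<xi>) y (x, t)
                = space_mollifier \<epsilon>x Ty r \<xi> (x, t)
                  * (\<Sum>k\<in>UNIV. time_mollifier \<epsilon>t (\<theta> k) t * y $ k))))"
proof -
  have sets: "\<Omega> \<in> sets borel" "T \<in> sets borel" "Ty \<in> sets borel"
    using assms(1,4,6) by (auto simp: is_interval_convex_1 intro: real_interval_borel_measurable)
  note hyps = sets(1) assms(2) sets(2) assms(5,8) sets(3)
  show ?thesis
  proof (intro conjI allI impI)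
    fix \<xi> k and u :: "st_point \<Rightarrow> real"
    assume "continuous_on (\<Omega> \<times> T) u \<and> bounded (u ` (\<Omega> \<times> T)) \<and> \<theta> k \<in> interior Ty"
    then show "((\<lambda>(\<epsilon>x, \<epsilon>t). observation_operator \<Omega> T Ty r \<theta> \<epsilon>x \<epsilon>t \<xi> u $ k)
          \<longlongrightarrow> u (r (\<theta> k) \<xi>, \<theta> k)) (at (0, 0) within {0<..} \<times> {0<..})"
      using L2_inner_observation_kernel_tendsto[OF assms(1) sets(2,3) assms(7,8), of u "\<theta> k" \<xi>]
      by (simp add: observation_operator_eq)
  next
    fix \<epsilon>x \<epsilon>t :: real and \<xi> :: "real ^ 'N"
    assume pos: "0 < \<epsilon>x" "0 < \<epsilon>t"
    show "observation_operator \<Omega> T Ty r \<theta> \<epsilon>x \<epsilon>t \<xi> \<in> L2_bounded_operators \<Omega> T"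
      unfolding observation_operator_eq
      by (intro L2_inner_vector_bounded observation_kernel_in_L2_space hyps pos)
    show "((\<lambda>\<xi>'. L2_onorm \<Omega> T (\<lambda>u. observation_operator \<Omega> T Ty r \<theta> \<epsilon>x \<epsilon>t \<xi>' u
                 - observation_operator \<Omega> T Ty r \<theta> \<epsilon>x \<epsilon>t \<xi> u)) \<longlongrightarrow> 0) (at \<xi>)"
      by (rule observation_operator_continuous[OF hyps pos])
    show "is_L2_adjoint \<Omega> T (observation_operator \<Omega> T Ty r \<theta> \<epsilon>x \<epsilon>t \<xi>)
            (L2_adjoint \<Omega> T (observation_operator \<Omega> T Ty r \<theta> \<epsilon>x \<epsilon>t \<xi>))"
      by (rule observation_operator_adjoint[OF hyps pos])
    show "AE (x, t) in lebesgue_on (\<Omega> \<times> T).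
            L2_adjoint \<Omega> T (observation_operator \<Omega> T Ty r \<theta> \<epsilon>x \<epsilon>t \<xi>) y (x, t)
            = space_mollifier \<epsilon>x Ty r \<xi> (x, t) * (\<Sum>k\<in>UNIV. time_mollifier \<epsilon>t (\<theta> k) t * y $ k)" for y
      by (rule observation_operator_adjoint[OF hyps pos])
  qed
qed

end
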